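(* Let $n\ge1$ and let $P_n$ be the path with $n+1$ vertices labelled $1,2,\ldots,n+1$ in order along the path. For a cycle $c$, its multiplicity is the number of orderings of the edges of $P_n$ whose product of edge-transpositions equals $c$. Let $c_0=(1,3,5,\ldots,6,4,2)$ be the $(n+1)$-cycle listing the odd elements of $\{1,\ldots,n+1\}$ in increasing order followed by the even elements in decreasing order. Then among all cycles arising as products of the edges of $P_n$ in some order, $c_0$ and $c_0^{-1}$ have the highest multiplicity, and every other such cycle has strictly smaller multiplicity.
   Context: Each edge $\{i,j\}$ is regarded as the transposition $(i,j)$; an ordering of the edges lists every edge exactly once, and its product is the product of the corresponding transpositions in that order. *)

theory Defs
  imports "HOL-Combinatorics.Cycles" "HOL-Combinatorics.Multiset_Permutations"
begin

definition path_edges :: "nat \<Rightarrow> nat set set" where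
  "path_edges n = {{i, i + 1} | i. i \<in> {1..n}}"

definition edge_transposition :: "nat set \<Rightarrow> nat \<Rightarrow> nat" where
  "edge_transposition e = transpose (Min e) (Max e)"

lemma edge_transposition_doubleton: "edge_transposition {i, j} = transpose i j"
  by (cases "i \<le> j") (simp_all add: edge_transposition_def transpose_commute)

(* Permutations are composed as functions, so the last edge acts first. The opposite convention
   gives the product of the reversed ordering, hence the same multiplicities. *)
definition edge_product :: "nat set list \<Rightarrow> nat \<Rightarrow> nat" where
  "edge_product es = foldr (\<circ>) (map edge_transposition es) id"

definition multiplicity_on_path :: "nat \<Rightarrow> (nat \<Rightarrow> nat) \<Rightarrow> nat" where
  "multiplicity_on_path n c =
     card {es \<in> permutations_of_set (path_edges n). edge_product es = c}"

definition is_cycle :: "(nat \<Rightarrow> nat) \<Rightarrow> bool" where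
  "is_cycle c \<longleftrightarrow> (\<exists>cs. cycle cs \<and> 2 \<le> length cs \<and> c = cycle_of_list cs)"

definition path_cycles :: "nat \<Rightarrow> (nat \<Rightarrow> nat) set" where
  "path_cycles n = {c. is_cycle c \<and> (\<exists>es \<in> permutations_of_set (path_edges n). edge_product es = c)}"

(* cycle_of_list sends each entry of the list to the next one and the last to the first. *)
definition zigzag_cycle :: "nat \<Rightarrow> nat \<Rightarrow> nat" where
  "zigzag_cycle n =
     cycle_of_list (filter odd [1..<n + 2] @ rev (filter even [1..<n + 2]))"

end

theory Submission
  imports Defs
begin

text \<open>
  Write \<open>t\<^sub>i\<close> for the transposition \<open>(i, i+1)\<close>. As \<open>t\<^sub>i\<close> and \<open>t\<^sub>j\<close> commute unless
  \<open>\<bar>i - j\<bar> \<le> 1\<close>, the product of an ordering only depends on the word recording for each \<open>i\<close> whether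
  \<open>i\<close> comes before \<open>i+1\<close>, and distinct words give distinct products. So multiplicities count
  permutations with a prescribed up-down pattern. Refining the count by the position of the largest
  edge gives a recursion by partial sums; when two consecutive letters agree, the partial sum runs
  over the small end of a monotone sequence, and replacing it by the large end shows that the
  alternating words maximise the count at every position. The cycle \<open>c\<^sub>0\<close> belongs to an alternating
  word, because the new vertex enters the cycle in the middle, next to its predecessor, which
  alternately lies in the odd and in the even part.
\<close>

section \<open>Up-down counts and the extremality of alternating words\<close>

fun alternating :: "bool \<Rightarrow> nat \<Rightarrow> bool list" where
  "alternating b 0 = []"
| "alternating b (Suc n) = b # alternating (\<not> b) n"

lemma length_alternating [simp]: "length (alternating b n) = n"
  by (induction n arbitrary: b) auto

lemma map_Not_alternating [simp]: "map Not (alternating b n) = alternating (\<not> b) n"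
  by (induction n arbitrary: b) auto

lemma map_Not_Not [simp]: "map Not (map Not w) = w"
  by (induction w) auto

text \<open>
  Words are read from the largest edge downwards: the head of a word of length \<open>n\<close> says whether
  edge \<open>n\<close> precedes edge \<open>n + 1\<close>. The number \<open>pos_count w k\<close> counts the orderings with word \<open>w\<close>
  in which the largest edge has index \<open>k\<close>; it is meaningful for \<open>k \<le> length w\<close> only.
\<close>

fun pos_count :: "bool list \<Rightarrow> nat \<Rightarrow> nat" where
  "pos_count [] k = (if k = 0 then 1 else 0)"
| "pos_count (True # w) k = (\<Sum>j<k. pos_count w j)"
| "pos_count (False # w) k = (\<Sum>j\<in>{k..length w}. pos_count w j)"

definition total_count :: "bool list \<Rightarrow> nat" where
  "total_count w = (\<Sum>k\<le>length w. pos_count w k)"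

text \<open>Reversing an ordering negates every letter and moves the largest edge from index
  \<open>k\<close> to index \<open>length w - k\<close>. This reflection later halves the case
  distinctions on the head of a word.\<close>

lemma pos_count_map_Not:
  "k \<le> length w \<Longrightarrow> pos_count (map Not w) k = pos_count w (length w - k)"
proof (induction w arbitrary: k)
  case Nil
  then show ?case by simp
next
  case (Cons b w)
  show ?case
  proof (cases b)
    case True
    have "(\<Sum>j\<in>{k..length w}. pos_count (map Not w) j)
        = (\<Sum>j\<in>{k..length w}. pos_count w (length w - j))"
      using Cons.IH by (intro sum.cong) auto
    also have "\<dots> = (\<Sum>j<Suc (length w) - k. pos_count w j)"
      by (rule sum.reindex_bij_witness[of _ "\<lambda>j. length w - j" "\<lambda>j. length w - j"]) auto
    finally show ?thesis using True by simp
  next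
    case False
    have "(\<Sum>j<k. pos_count (map Not w) j) = (\<Sum>j<k. pos_count w (length w - j))"
      using Cons.IH Cons.prems by (intro sum.cong) auto
    also have "\<dots> = (\<Sum>j\<in>{Suc (length w) - k..length w}. pos_count w j)"
      by (rule sum.reindex_bij_witness[of _ "\<lambda>j. length w - j" "\<lambda>j. length w - j"])
        (use Cons.prems in auto)
    finally show ?thesis using False by simp
  qed
qed

lemma total_count_map_Not: "total_count (map Not w) = total_count w"
proof -
  have "(\<Sum>k\<le>length w. pos_count (map Not w) k) = (\<Sum>k\<le>length w. pos_count w (length w - k))"
    by (intro sum.cong) (auto simp: pos_count_map_Not)
  also have "\<dots> = (\<Sum>k\<le>length w. pos_count w k)"
    by (rule sum.reindex_bij_witness[of _ "\<lambda>j. length w - j" "\<lambda>j. length w - j"]) auto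
  finally show ?thesis by (simp add: total_count_def)
qed

lemma pos_count_True_mono: "i \<le> j \<Longrightarrow> pos_count (True # w) i \<le> pos_count (True # w) j"
  by (auto intro: sum_mono2)

lemma pos_count_True_length: "pos_count (True # w) (Suc (length w)) = total_count w"
  by (simp add: total_count_def lessThan_Suc_atMost)

lemma pos_count_False_0: "pos_count (False # w) 0 = total_count w"
  by (simp add: total_count_def atMost_atLeast0)

text \<open>The total of the tail reappears as the value at an extreme index: the last one for head
  \<open>True\<close>, index 0 for head \<open>False\<close>. Positivity yields strict inequalities
  below, and later an ordering for every word.\<close>

lemma total_count_pos: "total_count w > 0"
proof (induction w)
  case Nil
  then show ?case by (simp add: total_count_def)
next
  case (Cons b w)
  have "\<exists>k\<le>Suc (length w). pos_count (b # w) k > 0"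
    using Cons pos_count_True_length pos_count_False_0 by (cases b) fastforce+
  then show ?case
    by (auto simp: total_count_def simp del: sum.atMost_Suc intro!: sum_pos2)
qed

text \<open>The recursion forms partial sums, so the induction needs the comparison at every index
  and not only for totals. The head is kept fixed because the two alternating words are not
  comparable index by index: at index 0 only head \<open>False\<close> has a positive count, at the
  last index only head \<open>True\<close>.\<close>

lemma pos_count_le_alternating:
  "\<lbrakk>length w = n; k \<le> Suc n\<rbrakk> \<Longrightarrow> pos_count (b # w) k \<le> pos_count (alternating b (Suc n)) k"
proof (induction n arbitrary: b w k)
  case 0
  then show ?case by simp
next
  case (Suc n)
  have *: "pos_count (True # w) k \<le> pos_count (alternating True (Suc (Suc n))) k"
    if w: "length w = Suc n" and k: "k \<le> Suc (Suc n)" for w k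
  proof -
    obtain c v where cv: "w = c # v" "length v = n" using w by (cases w) auto
    have "(\<Sum>j<k. pos_count w j) \<le> (\<Sum>j<k. pos_count (alternating False (Suc n)) j)"
    proof (cases c)
      case False
      then show ?thesis using Suc.IH[of v _ False] cv k by (intro sum_mono) simp
    next
      case True
      \<comment> \<open>Here the counts of \<open>w\<close> increase with the index. Shifting by
        \<open>d\<close> moves the first \<open>k\<close> indices onto the last \<open>k\<close> of
        the indices up to \<open>length w\<close>; reflection then turns this sum into one for
        \<open>map Not w\<close>, whose head \<open>False\<close> is the one the induction
        hypothesis needs.\<close>
      define d where "d = Suc (Suc n) - k"
      have "(\<Sum>j<k. pos_count w j) \<le> (\<Sum>j<k. pos_count w (j + d))"
        using cv True pos_count_True_mono[of _ "_ + d" v] by (auto intro!: sum_mono simp del: pos_count.simps)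
      also have "\<dots> = (\<Sum>j<k. pos_count w (k - Suc j + d))"
        by (rule sum.nat_diff_reindex[symmetric])
      also have "\<dots> = (\<Sum>j<k. pos_count (map Not w) j)"
      proof (rule sum.cong)
        fix j assume "j \<in> {..<k}"
        then have "k - Suc j + d = length w - j" "j \<le> length w" using w k by (auto simp: d_def)
        then show "pos_count w (k - Suc j + d) = pos_count (map Not w) j"
          by (simp add: pos_count_map_Not)
      qed simp
      also have "\<dots> \<le> (\<Sum>j<k. pos_count (alternating False (Suc n)) j)"
        using Suc.IH[of "map Not v" _ False] cv k True by (intro sum_mono) simp
      finally show ?thesis .
    qed
    then show ?thesis by simp
  qed
  show ?case
  proof (cases b)
    case True
    then show ?thesis using * Suc.prems by simp
  next
    case False
    \<comment> \<open>Reflection reduces head \<open>False\<close> to the claim for head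
      \<open>True\<close>, at the mirrored index.\<close>
    let ?k = "Suc (Suc n) - k"
    have "pos_count (b # w) k = pos_count (map Not (True # map Not w)) k"
      using False by (simp add: comp_def)
    also have "\<dots> = pos_count (True # map Not w) ?k"
      using Suc.prems by (subst pos_count_map_Not) auto
    also have "\<dots> \<le> pos_count (alternating True (Suc (Suc n))) ?k"
      using Suc.prems by (intro *) auto
    also have "\<dots> = pos_count (map Not (alternating True (Suc (Suc n)))) k"
      using Suc.prems by (subst pos_count_map_Not) auto
    also have "\<dots> = pos_count (alternating b (Suc (Suc n))) k"
      using False by (subst map_Not_alternating) simp
    finally show ?thesis .
  qed
qed

text \<open>All terms are already compared by \<open>pos_count_le_alternating\<close>, so one index
  with strict inequality suffices. It lies near the small end if the first two letters agree and at
  the large end otherwise.\<close>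

lemma total_count_True_less:
  "\<lbrakk>length w = n; w \<noteq> alternating False n\<rbrakk>
    \<Longrightarrow> total_count (True # w) < total_count (alternating True (Suc n))"
proof (induction n arbitrary: w)
  case 0
  then show ?case by simp
next
  case (Suc n)
  obtain c v where cv: "w = c # v" "length v = n" using Suc.prems by (cases w) auto
  have "\<exists>k\<le>Suc (Suc n). pos_count (True # w) k < pos_count (alternating True (Suc (Suc n))) k"
  proof (cases c)
    case True
    \<comment> \<open>Two leading letters \<open>True\<close> force two smaller edges before the
      largest one, so it cannot have index 1.\<close>
    have "pos_count (True # w) 1 = 0" using cv True by simp
    moreover have "pos_count (alternating True (Suc (Suc n))) 1 = total_count (alternating True n)"
      using pos_count_False_0[of "alternating True n"] by simp
    ultimately show ?thesis
      using total_count_pos[of "alternating True n"] by (intro exI[of _ 1]) simp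
  next
    case False
    \<comment> \<open>The induction hypothesis speaks of head \<open>True\<close>, so it is applied
      to the negation of \<open>w\<close>. At the last index both counts are the totals of the
      tails, which carries the strict inequality over.\<close>
    have "map Not v \<noteq> alternating False n"
    proof
      assume "map Not v = alternating False n"
      then have "map Not (map Not v) = alternating True n" by (simp del: map_map)
      then show False using Suc.prems(2) cv False unfolding map_Not_Not by simp
    qed
    then have "total_count (True # map Not v) < total_count (alternating True (Suc n))"
      using Suc.IH cv by simp
    moreover have "total_count (True # map Not v) = total_count w"
      using total_count_map_Not[of w] cv False by simp
    moreover have "total_count (alternating True (Suc n)) = total_count (alternating False (Suc n))"
      using total_count_map_Not[of "alternating False (Suc n)"] by simp
    moreover have "pos_count (True # w) (Suc (Suc n)) = total_count w"
      using pos_count_True_length[of w] Suc.prems by simp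
    moreover have "pos_count (alternating True (Suc (Suc n))) (Suc (Suc n))
        = total_count (alternating False (Suc n))"
      using pos_count_True_length[of "alternating False (Suc n)"] by simp
    ultimately show ?thesis by (intro exI[of _ "Suc (Suc n)"]) linarith
  qed
  then have "(\<Sum>k\<le>Suc (Suc n). pos_count (True # w) k)
      < (\<Sum>k\<le>Suc (Suc n). pos_count (alternating True (Suc (Suc n))) k)"
    using Suc.prems by (intro sum_strict_mono_ex1) (use pos_count_le_alternating in blast)+
  then show ?case unfolding total_count_def using Suc.prems by simp
qed

lemma total_count_less_alternating:
  assumes "w \<noteq> alternating True (length w)" "w \<noteq> alternating False (length w)"
  shows "total_count w < total_count (alternating c (length w))"
proof -
  have eq: "total_count (alternating c n) = total_count (alternating True n)" for n
    using total_count_map_Not[of "alternating True n"] by (cases c) auto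
  obtain b v where w: "w = b # v" using assms by (cases w) auto
  show ?thesis
  proof (cases b)
    case True
    then show ?thesis unfolding eq using total_count_True_less[of v "length v"] assms w by auto
  next
    case False
    have "map Not v \<noteq> alternating False (length v)"
    proof
      assume "map Not v = alternating False (length v)"
      then have "map Not (map Not v) = alternating True (length v)" by (simp del: map_map)
      then show False using assms w False unfolding map_Not_Not by simp
    qed
    then have "total_count (True # map Not v) < total_count (alternating True (length w))"
      using total_count_True_less[of "map Not v" "length v"] w by simp
    then show ?thesis unfolding eq using total_count_map_Not[of w] w False by simp
  qed
qed

section \<open>Products of adjacent transpositions and their words\<close>

definition adj_product :: "nat list \<Rightarrow> nat \<Rightarrow> nat" where
  "adj_product es = foldr (\<circ>) (map (\<lambda>i. transpose i (Suc i)) es) id"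

lemma adj_product_Nil [simp]: "adj_product [] = id"
  and adj_product_Cons [simp]: "adj_product (i # es) = transpose i (Suc i) \<circ> adj_product es"
  by (simp_all add: adj_product_def)

lemma adj_product_append: "adj_product (xs @ ys) = adj_product xs \<circ> adj_product ys"
  by (induction xs) (auto simp: comp_assoc)

lemma transpose_comp_commute:
  "\<lbrakk>a \<noteq> c; a \<noteq> d; b \<noteq> c; b \<noteq> d\<rbrakk>
    \<Longrightarrow> transpose a b \<circ> transpose c d = transpose c d \<circ> transpose a b"
  by (auto simp: fun_eq_iff transpose_def)

lemma adj_product_commute:
  "\<forall>i\<in>set es. Suc i < m \<Longrightarrow>
    adj_product es \<circ> transpose m (Suc m) = transpose m (Suc m) \<circ> adj_product es"
proof (induction es)
  case (Cons i es)
  have "adj_product es \<circ> transpose m (Suc m) = transpose m (Suc m) \<circ> adj_product es"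
    by (rule Cons.IH) (use Cons.prems in simp)
  then have "adj_product (i # es) \<circ> transpose m (Suc m)
      = transpose i (Suc i) \<circ> transpose m (Suc m) \<circ> adj_product es"
    by (simp only: adj_product_Cons comp_assoc)
  also have "\<dots> = transpose m (Suc m) \<circ> adj_product (i # es)"
    using Cons.prems by (subst transpose_comp_commute) (auto simp: comp_assoc)
  finally show ?case .
qed simp

text \<open>Among the old edges only \<open>Suc n\<close> shares a vertex with the new edge. The new
  transposition therefore commutes past the part of the ordering that does not contain
  \<open>Suc n\<close> and ends up on that outer side.\<close>

lemma adj_product_insert:
  assumes es: "es \<in> permutations_of_set {1..Suc n}"
  shows "adj_product (take k es @ Suc (Suc n) # drop k es) =
    (if Suc n \<in> set (take k es) then adj_product es \<circ> transpose (Suc (Suc n)) (Suc (Suc (Suc n)))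
     else transpose (Suc (Suc n)) (Suc (Suc (Suc n))) \<circ> adj_product es)"
    (is "?L = (if _ then _ \<circ> ?t else _)")
proof -
  have split: "adj_product es = adj_product (take k es) \<circ> adj_product (drop k es)"
    by (simp flip: adj_product_append)
  have L: "?L = adj_product (take k es) \<circ> ?t \<circ> adj_product (drop k es)"
    by (simp add: adj_product_append comp_assoc)
  have S: "set (take k es) \<subseteq> {1..Suc n}" "set (drop k es) \<subseteq> {1..Suc n}"
    using permutations_of_setD[OF es] by (auto dest: in_set_takeD in_set_dropD)
  have "distinct (take k es @ drop k es)"
    using permutations_of_setD[OF es] by simp
  then have D: "set (take k es) \<inter> set (drop k es) = {}"
    unfolding distinct_append by blast
  show ?thesis
  proof (cases "Suc n \<in> set (take k es)")
    case True
    have "\<forall>i\<in>set (drop k es). Suc i < Suc (Suc n)"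
    proof
      fix i assume "i \<in> set (drop k es)"
      then have "i \<noteq> Suc n" "i \<le> Suc n" using D S True by auto
      then show "Suc i < Suc (Suc n)" by simp
    qed
    from adj_product_commute[OF this] True show ?thesis by (simp add: L split comp_assoc)
  next
    case False
    have "\<forall>i\<in>set (take k es). Suc i < Suc (Suc n)"
    proof
      fix i assume "i \<in> set (take k es)"
      then have "i \<noteq> Suc n" "i \<le> Suc n" using S False by auto
      then show "Suc i < Suc (Suc n)" by simp
    qed
    from adj_product_commute[OF this] False show ?thesis
      unfolding L split by (simp add: comp_assoc)
  qed
qed

text \<open>A word of length l describes l + 1 edges, so the empty word stands for edge 1 alone and
  the head of \<open>b # w\<close> introduces edge \<open>length w + 2\<close>. For head
  \<open>True\<close> this edge comes after its predecessor and is composed on the right.\<close>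

fun word_perm :: "bool list \<Rightarrow> nat \<Rightarrow> nat" where
  "word_perm [] = transpose 1 2"
| "word_perm (b # w) =
    (let t = transpose (length w + 2) (length w + 3)
     in if b then word_perm w \<circ> t else t \<circ> word_perm w)"

lemma word_perm_fixes: "x > length w + 2 \<Longrightarrow> word_perm w x = x"
  by (induction w) (auto simp: Let_def)

lemma bij_word_perm: "bij (word_perm w)"
  by (induction w) (auto simp: Let_def intro: bij_comp)

text \<open>Each factor is an involution, so inversion moves it to the opposite side of the product
  built so far, which is what negating its letter does.\<close>

lemma word_perm_map_Not: "word_perm (map Not w) = inv (word_perm w)"
proof (induction w)
  case Nil
  then show ?case by (simp add: inv_unique_comp)
next
  case (Cons b w)
  have "inv (transpose (length w + 2) (length w + 3)) = transpose (length w + 2) (length w + 3)"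
    by (rule inv_unique_comp) simp_all
  then show ?case
    using o_inv_distrib[OF bij_word_perm[of w] bij_transpose]
      o_inv_distrib[OF bij_transpose bij_word_perm[of w]] Cons
    by (simp add: Let_def del: o_apply)
qed

text \<open>The head can be read off from the image of the highest vertex; after that the top
  transposition cancels and the induction hypothesis recovers the tail.\<close>

lemma word_perm_inj: "\<lbrakk>length v = length w; word_perm v = word_perm w\<rbrakk> \<Longrightarrow> v = w"
proof (induction v w rule: list_induct2')
  case (4 b v c w)
  define t where "t = transpose (length w + 2) (length w + 3)"
  have len: "length v = length w" using 4 by simp
  have top: "word_perm u (length u + 2) \<noteq> length u + 2" for u
  proof (cases u)
    case (Cons a u')
    have "word_perm u' (length u' + 2) \<noteq> length u' + 3"
    proof
      assume "word_perm u' (length u' + 2) = length u' + 3"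
      also have "\<dots> = word_perm u' (length u' + 3)" by (simp add: word_perm_fixes)
      finally show False using bij_is_inj[OF bij_word_perm[of u']] by (simp only: inj_eq)
    qed
    then show ?thesis
      using Cons word_perm_fixes[of u' "length u' + 3"] by (auto simp: Let_def numeral_3_eq_3)
  qed (simp add: transpose_def)
  \<comment> \<open>For head \<open>False\<close> the new transposition acts after
    \<open>word_perm u\<close>, which fixes \<open>length u + 3\<close>, and sends it to
    \<open>length u + 2\<close>. For head \<open>True\<close> it acts first, and \<open>top\<close>
    keeps the image away from \<open>length u + 2\<close>.\<close>
  have top_edge: "word_perm (a # u) (length u + 3) = length u + 2 \<longleftrightarrow> \<not> a" for a u
    using top[of u] word_perm_fixes[of u "length u + 3"] by (auto simp: Let_def)
  have "b = c" using top_edge[of b v] top_edge[of c w] 4 len by simp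
  moreover have "word_perm v = word_perm w"
  proof (cases c)
    case True
    then have "word_perm v \<circ> t = word_perm w \<circ> t"
      using "4.prems"(2) len \<open>b = c\<close> by (simp add: Let_def t_def fun_eq_iff)
    then have "word_perm v \<circ> t \<circ> t = word_perm w \<circ> t \<circ> t" by (rule arg_cong)
    then show ?thesis by (simp add: comp_assoc t_def)
  next
    case False
    then have "t \<circ> word_perm v = t \<circ> word_perm w"
      using "4.prems"(2) len \<open>b = c\<close> by (simp add: Let_def t_def fun_eq_iff)
    then have "t \<circ> (t \<circ> word_perm v) = t \<circ> (t \<circ> word_perm w)" by (rule arg_cong)
    then show ?thesis by (simp add: t_def flip: comp_assoc)
  qed
  ultimately show ?case using 4 len by simp
qed auto

section \<open>Counting the orderings with a given word\<close>

lemma permutations_insert: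
  "\<lbrakk>es \<in> permutations_of_set {1..n}; k \<le> n\<rbrakk>
    \<Longrightarrow> take k es @ Suc n # drop k es \<in> permutations_of_set {1..Suc n}"
proof -
  assume es: "es \<in> permutations_of_set {1..n}"
  note D = permutations_of_setD[OF es]
  have "set (take k es @ drop k es) = {1..n}" "distinct (take k es @ drop k es)"
    using D by simp_all
  then have *: "set (take k es) \<union> set (drop k es) = {1..n}"
    "set (take k es) \<inter> set (drop k es) = {}"
    unfolding distinct_append set_append by blast+
  moreover have "Suc n \<notin> {1..n}" by simp
  then have "Suc n \<notin> set (take k es)" "Suc n \<notin> set (drop k es)" using * by blast+
  moreover have "{1..Suc n} = insert (Suc n) {1..n}" by auto
  ultimately show ?thesis using * D by (intro permutations_of_setI) auto
qed

lemma permutations_insertE: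
  assumes "fs \<in> permutations_of_set {1..Suc n}"
  obtains es k where "es \<in> permutations_of_set {1..n}" "k \<le> n"
    "fs = take k es @ Suc n # drop k es"
proof -
  note D = permutations_of_setD[OF assms]
  have "Suc n \<in> set fs" using D by simp
  then obtain xs ys where fs: "fs = xs @ Suc n # ys" by (meson split_list)
  have "set (xs @ ys) = {1..Suc n} - {Suc n}" using D fs by auto
  also have "\<dots> = {1..n}" by auto
  finally have es: "xs @ ys \<in> permutations_of_set {1..n}" using D fs by (intro permutations_of_setI) auto
  moreover have "length xs \<le> n" using length_finite_permutations_of_set[OF es] by simp
  ultimately show ?thesis using fs by (intro that[of "xs @ ys" "length xs"]) auto
qed

lemma adj_product_insert_word_perm:
  assumes es: "es \<in> permutations_of_set {1..Suc n}" and w: "length w = n" "adj_product es = word_perm w"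
  shows "adj_product (take k es @ Suc (Suc n) # drop k es)
    = word_perm ((Suc n \<in> set (take k es)) # w)"
  using adj_product_insert[OF es, of k] w by (simp add: numeral_3_eq_3)

lemma adj_product_eq_word_perm:
  "es \<in> permutations_of_set {1..Suc n} \<Longrightarrow> \<exists>w. length w = n \<and> adj_product es = word_perm w"
proof (induction n arbitrary: es)
  case 0
  then show ?case by (auto simp: numeral_2_eq_2)
next
  case (Suc n)
  from Suc.prems obtain fs k where fs: "fs \<in> permutations_of_set {1..Suc n}"
    "es = take k fs @ Suc (Suc n) # drop k fs" by (rule permutations_insertE)
  then obtain w where "length w = n" "adj_product fs = word_perm w" using Suc.IH by blast
  then show ?case using adj_product_insert_word_perm fs by (metis length_Cons)
qed

text \<open>The up-down pattern is expressed through the product, which determines it by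
  \<open>word_perm_inj\<close>; the cardinality is then a multiplicity without further
  translation.\<close>

definition word_orderings :: "bool list \<Rightarrow> nat list set" where
  "word_orderings w =
    {es \<in> permutations_of_set {1..Suc (length w)}. adj_product es = word_perm w}"

lemma length_word_orderings: "es \<in> word_orderings w \<Longrightarrow> length es = Suc (length w)"
  by (auto simp: word_orderings_def dest: length_finite_permutations_of_set)

lemma finite_word_orderings [simp]: "finite (word_orderings w)"
  by (simp add: word_orderings_def)

lemma word_orderings_nth_unique:
  assumes "es \<in> word_orderings w" "es ! i = x" "es ! j = x" "i \<le> length w" "j \<le> length w"
  shows "i = j"
proof -
  have "distinct es" using assms(1) by (auto simp: word_orderings_def dest: permutations_of_setD)
  then show ?thesis
    using assms(2-) length_word_orderings[OF assms(1)] nth_eq_iff_index_eq[of es i j] by simp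
qed

text \<open>Inserting the top edge prepends one letter to the word of \<open>es\<close>, and
  \<open>word_perm_inj\<close> allows comparing the resulting words letter by letter.\<close>

lemma insert_in_word_orderings_iff:
  assumes es: "es \<in> permutations_of_set {1..Suc (length w)}" and k: "k \<le> Suc (length w)"
  shows "take k es @ Suc (Suc (length w)) # drop k es \<in> word_orderings (b # w)
    \<longleftrightarrow> es \<in> word_orderings w \<and> (b \<longleftrightarrow> Suc (length w) \<in> set (take k es))"
proof -
  obtain v where v: "length v = length w" "adj_product es = word_perm v"
    using adj_product_eq_word_perm[OF es] by blast
  have "word_perm ((Suc (length w) \<in> set (take k es)) # v) = word_perm (b # w)
      \<longleftrightarrow> (Suc (length w) \<in> set (take k es)) # v = b # w"
    using word_perm_inj[of "(Suc (length w) \<in> set (take k es)) # v" "b # w"] v by auto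
  moreover have "word_perm v = word_perm w \<longleftrightarrow> v = w" using word_perm_inj v by blast
  ultimately show ?thesis
    using permutations_insert[OF es k] es adj_product_insert_word_perm[OF es v, of k] v
    by (auto simp: word_orderings_def)
qed

text \<open>Deleting the largest edge from index \<open>k\<close> is a bijection onto the orderings
  for the tail whose own largest edge has an admissible index. Summing over these indices reproduces
  the recursion of \<open>pos_count\<close>.\<close>

lemma card_word_orderings_pos:
  "k \<le> length w \<Longrightarrow> card {es \<in> word_orderings w. es ! k = Suc (length w)} = pos_count w k"
proof (induction w arbitrary: k)
  case Nil
  have "{es \<in> word_orderings []. es ! 0 = 1} = {[1]}"
    by (auto simp: word_orderings_def numeral_2_eq_2)
  then show ?case using Nil by simp
next
  case (Cons b w)
  let ?n = "length w"
  define P where "P j = {es \<in> word_orderings w. es ! j = Suc ?n}" for j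
  \<comment> \<open>These are the admissible old indices of the previous largest edge. Insertion at
    \<open>k\<close> pushes the entry at \<open>k\<close> itself to the right, so \<open>k\<close>
    belongs to the case \<open>False\<close>.\<close>
  define J where "J = (if b then {..<k} else {k..?n})"
  have J: "J \<subseteq> {..?n}" using Cons.prems by (auto simp: J_def)
  define I where "I = (\<lambda>es. take k es @ Suc (Suc ?n) # drop k es)"
  have lenk: "k \<le> length es" if "es \<in> word_orderings w" for es
    using Cons.prems length_word_orderings[OF that] by simp
  have inJ: "(\<exists>j\<in>J. es ! j = Suc ?n) \<longleftrightarrow> (b \<longleftrightarrow> Suc ?n \<in> set (take k es))"
    if es: "es \<in> word_orderings w" for es
  proof -
    have len: "length es = Suc ?n" by (rule length_word_orderings[OF es])
    have d: "distinct es" "Suc ?n \<in> set es"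
      using es by (auto simp: word_orderings_def dest: permutations_of_setD)
    then obtain i where i: "i < length es" "es ! i = Suc ?n" by (auto simp: in_set_conv_nth)
    have uniq: "es ! j = Suc ?n \<longleftrightarrow> j = i" if "j < length es" for j
      using d i that nth_eq_iff_index_eq by metis
    have "Suc ?n \<in> set (take k es) \<longleftrightarrow> (\<exists>j<k. j < length es \<and> es ! j = Suc ?n)"
      by (auto simp: in_set_conv_nth)
    also have "\<dots> \<longleftrightarrow> i < k" using uniq i by auto
    finally have "(b \<longleftrightarrow> Suc ?n \<in> set (take k es)) \<longleftrightarrow> i \<in> J"
      using i len by (auto simp: J_def)
    moreover have "(\<exists>j\<in>J. es ! j = Suc ?n) \<longleftrightarrow> i \<in> J" using uniq J i len by (auto simp: subset_iff less_Suc_eq_le)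
    ultimately show ?thesis by simp
  qed
  have "{es \<in> word_orderings (b # w). es ! k = Suc (Suc ?n)} = I ` (\<Union>j\<in>J. P j)"
  proof (intro equalityI subsetI)
    fix fs assume fs: "fs \<in> {es \<in> word_orderings (b # w). es ! k = Suc (Suc ?n)}"
    then have p: "fs \<in> permutations_of_set {1..Suc (Suc ?n)}" by (simp add: word_orderings_def)
    then obtain es i where es: "es \<in> permutations_of_set {1..Suc ?n}" "i \<le> Suc ?n"
      "fs = take i es @ Suc (Suc ?n) # drop i es" by (rule permutations_insertE)
    have len: "length es = Suc ?n" using length_finite_permutations_of_set[OF es(1)] by simp
    have "fs ! i = Suc (Suc ?n)" using es len by (simp add: nth_append)
    moreover have "i < length fs" "k < length fs" using es len Cons.prems by auto
    ultimately have "i = k"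
      using fs permutations_of_setD(2)[OF p] nth_eq_iff_index_eq by (metis (mono_tags, lifting) mem_Collect_eq)
    then have I: "fs = I es" using es by (simp add: I_def)
    have "es \<in> word_orderings w \<and> (b \<longleftrightarrow> Suc ?n \<in> set (take k es))"
      using fs es Cons.prems \<open>i = k\<close> by (subst insert_in_word_orderings_iff[symmetric]) auto
    then show "fs \<in> I ` (\<Union>j\<in>J. P j)" using inJ I by (auto simp: P_def)
  next
    fix fs assume "fs \<in> I ` (\<Union>j\<in>J. P j)"
    then obtain es j where es: "fs = I es" "j \<in> J" "es \<in> word_orderings w" "es ! j = Suc ?n"
      by (auto simp: P_def)
    have p: "es \<in> permutations_of_set {1..Suc ?n}" using es by (simp add: word_orderings_def)
    have "fs \<in> word_orderings (b # w)"
      using insert_in_word_orderings_iff[OF p, of k b] Cons.prems es inJ by (auto simp: I_def)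
    moreover have "fs ! k = Suc (Suc ?n)" using lenk es by (simp add: I_def nth_append)
    ultimately show "fs \<in> {es \<in> word_orderings (b # w). es ! k = Suc (Suc ?n)}" by simp
  qed
  moreover have "inj_on I (\<Union>j\<in>J. P j)"
  proof (rule inj_onI)
    fix xs ys assume A: "xs \<in> (\<Union>j\<in>J. P j)" "ys \<in> (\<Union>j\<in>J. P j)" "I xs = I ys"
    then have "k \<le> length xs" "k \<le> length ys" by (auto simp: P_def lenk)
    then have "take k xs = take k ys \<and> drop k xs = drop k ys"
      using A(3) unfolding I_def by (subst (asm) append_eq_append_conv) auto
    then show "xs = ys" by (metis append_take_drop_id)
  qed
  moreover have "card (\<Union>j\<in>J. P j) = (\<Sum>j\<in>J. card (P j))"
  proof (rule card_UN_disjoint)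
    show "finite J" by (simp add: J_def)
    show "\<forall>j\<in>J. finite (P j)" by (simp add: P_def)
    show "\<forall>i\<in>J. \<forall>j\<in>J. i \<noteq> j \<longrightarrow> P i \<inter> P j = {}"
      using J by (auto simp: P_def subset_iff dest: word_orderings_nth_unique)
  qed
  moreover have "(\<Sum>j\<in>J. card (P j)) = (\<Sum>j\<in>J. pos_count w j)"
    using Cons.IH J by (intro sum.cong) (auto simp: P_def)
  moreover have "\<dots> = pos_count (b # w) k" by (cases b) (simp_all add: J_def)
  ultimately show ?case by (simp add: card_image)
qed

lemma card_word_orderings: "card (word_orderings w) = total_count w"
proof -
  define P where "P j = {es \<in> word_orderings w. es ! j = Suc (length w)}" for j
  have "word_orderings w = (\<Union>j\<in>{..length w}. P j)"
  proof -
    have "\<exists>j\<le>length w. es ! j = Suc (length w)" if es: "es \<in> word_orderings w" for es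
    proof -
      have "Suc (length w) \<in> set es"
        using es by (auto simp: word_orderings_def dest: permutations_of_setD)
      then show ?thesis
        using length_word_orderings[OF es] by (auto simp: in_set_conv_nth less_Suc_eq_le)
    qed
    then show ?thesis by (auto simp: P_def)
  qed
  moreover have "card (\<Union>j\<in>{..length w}. P j) = (\<Sum>j\<le>length w. card (P j))"
  proof (rule card_UN_disjoint)
    show "\<forall>i\<in>{..length w}. \<forall>j\<in>{..length w}. i \<noteq> j \<longrightarrow> P i \<inter> P j = {}"
      by (auto simp: P_def dest: word_orderings_nth_unique)
  qed (simp_all add: P_def)
  ultimately show ?thesis
    by (simp add: P_def card_word_orderings_pos total_count_def)
qed

section \<open>Transfer to the edges of the path\<close>

lemma permutations_path_edges:
  "permutations_of_set (path_edges n) = map (\<lambda>i. {i, Suc i}) ` permutations_of_set {1..n}"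
proof -
  have "inj_on (\<lambda>i. {i, Suc i}) {1..n}" by (auto simp: inj_on_def doubleton_eq_iff)
  moreover have "path_edges n = (\<lambda>i. {i, Suc i}) ` {1..n}" by (auto simp: path_edges_def)
  ultimately show ?thesis by (simp only: permutations_of_set_image_inj)
qed

lemma edge_product_map: "edge_product (map (\<lambda>i. {i, Suc i}) es) = adj_product es"
  by (simp add: edge_product_def adj_product_def comp_def edge_transposition_doubleton)

lemma multiplicity_word_perm:
  "multiplicity_on_path (Suc (length w)) (word_perm w) = total_count w"
proof -
  have "{es \<in> permutations_of_set (path_edges (Suc (length w))). edge_product es = word_perm w}
      = map (\<lambda>i. {i, Suc i}) ` word_orderings w"
    by (auto simp: permutations_path_edges word_orderings_def edge_product_map)
  moreover have "inj (map (\<lambda>i::nat. {i, Suc i}))"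
    by (rule inj_mapI) (auto simp: inj_on_def doubleton_eq_iff)
  ultimately show ?thesis
    unfolding multiplicity_on_path_def
    by (simp add: card_image inj_on_subset[OF _ subset_UNIV] card_word_orderings)
qed

lemma path_product_eq_word_perm:
  assumes "es \<in> permutations_of_set (path_edges (Suc n))"
  obtains w where "length w = n" "edge_product es = word_perm w"
proof -
  from assms obtain fs where "fs \<in> permutations_of_set {1..Suc n}" "edge_product es = adj_product fs"
    unfolding permutations_path_edges using edge_product_map by blast
  then show ?thesis using adj_product_eq_word_perm that by metis
qed

lemma word_perm_in_path_cycles:
  assumes "is_cycle (word_perm w)"
  shows "word_perm w \<in> path_cycles (Suc (length w))"
proof -
  have "word_orderings w \<noteq> {}"
    using card_word_orderings[of w] total_count_pos[of w] by auto
  then obtain es where "es \<in> word_orderings w" by blast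
  then show ?thesis
    using assms by (auto simp: path_cycles_def permutations_path_edges word_orderings_def
      edge_product_map intro!: bexI[of _ es])
qed

section \<open>Cycles given by lists, and the zigzag cycle\<close>

lemma cycle_of_list_append:
  "cycle_of_list (xs @ a # b # ys)
    = cycle_of_list (xs @ [a]) \<circ> transpose a b \<circ> cycle_of_list (b # ys)"
proof (induction xs)
  case (Cons x xs)
  then show ?case by (cases xs) (auto simp: comp_assoc)
qed simp

lemma inv_cycle_of_list: "inv (cycle_of_list cs) = cycle_of_list (rev cs)"
proof (induction cs rule: cycle_of_list.induct)
  case (1 i j cs)
  have "bij (cycle_of_list (j # cs))"
    using cycle_permutes permutes_bij by blast
  then have "inv (cycle_of_list (i # j # cs)) = cycle_of_list (rev (j # cs)) \<circ> transpose i j"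
    using 1 by (simp add: o_inv_distrib inv_unique_comp)
  also have "\<dots> = cycle_of_list (rev (i # j # cs))"
    using cycle_of_list_append[of "rev cs" j i "[]"] by (simp add: transpose_commute)
  finally show ?case .
qed simp_all

lemma is_cycle_inv: "is_cycle c \<Longrightarrow> is_cycle (inv c)"
  unfolding is_cycle_def by (metis distinct_rev inv_cycle_of_list length_rev)

lemma transpose_cycle_of_list_commute:
  "\<lbrakk>a \<notin> set cs; b \<notin> set cs\<rbrakk> \<Longrightarrow> cycle_of_list cs \<circ> transpose a b = transpose a b \<circ> cycle_of_list cs"
proof (induction cs rule: cycle_of_list.induct)
  case (1 i j cs)
  have "cycle_of_list (j # cs) \<circ> transpose a b = transpose a b \<circ> cycle_of_list (j # cs)"
    by (rule "1.IH") (use "1.prems" in simp_all)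
  then have "cycle_of_list (i # j # cs) \<circ> transpose a b
      = transpose i j \<circ> transpose a b \<circ> cycle_of_list (j # cs)"
    by (simp only: cycle_of_list.simps comp_assoc)
  also have "\<dots> = transpose a b \<circ> cycle_of_list (i # j # cs)"
    using "1.prems" by (subst transpose_comp_commute) (auto simp: comp_assoc)
  finally show ?case .
qed simp_all

text \<open>Inserting \<open>m\<close> replaces the factor (a b) of the cycle by (a m)(m b) = (b
  m)(a b). The transposition (b m) is disjoint from \<open>xs @ [a]\<close> and moves to the far
  left. The companion for the right side uses (a m)(m b) = (a b)(a m) in the same way.\<close>

lemma cycle_of_list_insert_left:
  assumes "distinct (xs @ a # m # b # ys)"
  shows "cycle_of_list (xs @ a # m # b # ys) = transpose b m \<circ> cycle_of_list (xs @ a # b # ys)"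
proof -
  have "transpose a m \<circ> transpose m b = transpose b m \<circ> transpose a b"
    using assms by (auto simp: fun_eq_iff transpose_def)
  then have "cycle_of_list (xs @ a # m # b # ys)
      = cycle_of_list (xs @ [a]) \<circ> transpose b m \<circ> transpose a b \<circ> cycle_of_list (b # ys)"
    by (simp add: cycle_of_list_append comp_assoc) (simp flip: comp_assoc)
  also have "\<dots> = transpose b m \<circ> cycle_of_list (xs @ a # b # ys)"
    using assms by (subst transpose_cycle_of_list_commute) (auto simp: cycle_of_list_append comp_assoc)
  finally show ?thesis .
qed

lemma cycle_of_list_insert_right:
  assumes "distinct (xs @ a # m # b # ys)"
  shows "cycle_of_list (xs @ a # m # b # ys) = cycle_of_list (xs @ a # b # ys) \<circ> transpose a m"
proof -
  have "transpose a m \<circ> transpose m b = transpose a b \<circ> transpose a m"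
    using assms by (auto simp: fun_eq_iff transpose_def)
  then have "cycle_of_list (xs @ a # m # b # ys)
      = cycle_of_list (xs @ [a]) \<circ> transpose a b \<circ> (transpose a m \<circ> cycle_of_list (b # ys))"
    by (simp add: cycle_of_list_append comp_assoc) (simp flip: comp_assoc)
  also have "transpose a m \<circ> cycle_of_list (b # ys) = cycle_of_list (b # ys) \<circ> transpose a m"
    using assms by (subst transpose_cycle_of_list_commute) auto
  finally show ?thesis by (simp only: cycle_of_list_append comp_assoc)
qed

definition zigzag_list :: "nat \<Rightarrow> nat list" where
  "zigzag_list n = filter odd [1..<n + 2] @ rev (filter even [1..<n + 2])"

lemma distinct_zigzag_list: "distinct (zigzag_list n)"
  by (auto simp: zigzag_list_def)

text \<open>The entries \<open>n\<close> and \<open>n + 1\<close> are the last odd and the first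
  even one, in an order given by the parity of \<open>n\<close>, and \<open>n + 2\<close> enters
  between them. The parity decides whether \<open>n + 1\<close> stands to its left or right, hence
  on which side the transposition is split off.\<close>

lemma zigzag_cycle_Suc:
  assumes "n \<ge> 1"
  shows "zigzag_cycle (Suc n) = (if even n then zigzag_cycle n \<circ> transpose (n + 1) (n + 2)
    else transpose (n + 1) (n + 2) \<circ> zigzag_cycle n)"
proof -
  define X where "X = filter odd [1..<n]"
  define Y where "Y = rev (filter even [1..<n])"
  have u: "[1..<n + 2] = [1..<n] @ [n, n + 1]" "[1..<n + 3] = [1..<n] @ [n, n + 1, n + 2]"
    using assms by (simp_all add: numeral_2_eq_2 numeral_3_eq_3)
  have z: "zigzag_cycle k = cycle_of_list (zigzag_list k)" for k
    by (simp add: zigzag_cycle_def zigzag_list_def)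
  have S: "zigzag_list (Suc n) = filter odd [1..<n + 3] @ rev (filter even [1..<n + 3])"
    by (simp add: zigzag_list_def numeral_3_eq_3)
  show ?thesis
  proof (cases "even n")
    case True
    have "zigzag_list n = X @ (n + 1) # n # Y" "zigzag_list (Suc n) = X @ (n + 1) # (n + 2) # n # Y"
      unfolding S zigzag_list_def[of n] u X_def Y_def using True by simp_all
    then show ?thesis
      using cycle_of_list_insert_right[of X "n + 1" "n + 2" n Y] distinct_zigzag_list[of "Suc n"] True
      unfolding z by simp
  next
    case False
    have "zigzag_list n = X @ n # (n + 1) # Y" "zigzag_list (Suc n) = X @ n # (n + 2) # (n + 1) # Y"
      unfolding S zigzag_list_def[of n] u X_def Y_def using False by simp_all
    then show ?thesis
      using cycle_of_list_insert_left[of X n "n + 2" "n + 1" Y] distinct_zigzag_list[of "Suc n"] False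
      unfolding z by simp
  qed
qed

lemma zigzag_cycle_eq_word_perm: "zigzag_cycle (Suc n) = word_perm (alternating (even n) n)"
proof (induction n)
  case 0
  have "[1..<3::nat] = [1, 2]" by (simp add: upt_rec)
  then show ?case by (simp add: zigzag_cycle_def numeral_2_eq_2)
next
  case (Suc n)
  have "alternating (even (Suc n)) (Suc n) = odd n # alternating (even n) n" by simp
  then show ?case
    using zigzag_cycle_Suc[of "Suc n"] Suc by (simp add: Let_def numeral_3_eq_3)
qed

lemma is_cycle_zigzag: "n \<ge> 1 \<Longrightarrow> is_cycle (zigzag_cycle n)"
proof -
  assume n: "n \<ge> 1"
  have "set (zigzag_list n) = {1..<n + 2}" by (auto simp: zigzag_list_def)
  then have "length (zigzag_list n) = n + 1"
    using distinct_card[OF distinct_zigzag_list[of n]] by simp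
  then show ?thesis
    unfolding is_cycle_def using n distinct_zigzag_list
    by (intro exI[of _ "zigzag_list n"]) (auto simp: zigzag_cycle_def zigzag_list_def)
qed

theorem theorem3p11:
  fixes n :: nat
  assumes "n \<ge> 1"
  shows "zigzag_cycle n \<in> path_cycles n
    \<and> inv (zigzag_cycle n) \<in> path_cycles n
    \<and> multiplicity_on_path n (inv (zigzag_cycle n)) = multiplicity_on_path n (zigzag_cycle n)
    \<and> (\<forall>c \<in> path_cycles n. c \<noteq> zigzag_cycle n \<and> c \<noteq> inv (zigzag_cycle n) \<longrightarrow>
          multiplicity_on_path n c < multiplicity_on_path n (zigzag_cycle n))"
proof -
  obtain m where m: "n = Suc m" using assms by (cases n) auto
  define b where "b = even m"
  have z: "zigzag_cycle n = word_perm (alternating b m)"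
    by (simp add: m b_def zigzag_cycle_eq_word_perm)
  \<comment> \<open>Inversion negates all letters, so the inverse belongs to the other alternating
    word.\<close>
  have iz: "inv (zigzag_cycle n) = word_perm (alternating (\<not> b) m)"
    unfolding z by (simp flip: word_perm_map_Not)
  have mult: "multiplicity_on_path n (word_perm w) = total_count w" if "length w = m" for w
    using multiplicity_word_perm[of w] that m by simp
  have "zigzag_cycle n \<in> path_cycles n"
    using word_perm_in_path_cycles[of "alternating b m"] is_cycle_zigzag[OF assms] z m by simp
  moreover have "inv (zigzag_cycle n) \<in> path_cycles n"
    using word_perm_in_path_cycles[of "alternating (\<not> b) m"]
      is_cycle_inv[OF is_cycle_zigzag[OF assms]] iz m by simp
  moreover have "multiplicity_on_path n (inv (zigzag_cycle n)) = multiplicity_on_path n (zigzag_cycle n)"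
    unfolding iz unfolding z using total_count_map_Not[of "alternating b m"] by (simp add: mult)
  moreover have "multiplicity_on_path n c < multiplicity_on_path n (zigzag_cycle n)"
    if c: "c \<in> path_cycles n" "c \<noteq> zigzag_cycle n" "c \<noteq> inv (zigzag_cycle n)" for c
  proof -
    obtain w where w: "length w = m" "c = word_perm w"
      using c(1) m path_product_eq_word_perm by (auto simp: path_cycles_def)
    \<comment> \<open>The two excluded cycles account for both alternating words, whatever the
      parity of \<open>m\<close>.\<close>
    have "w \<noteq> alternating b m" "w \<noteq> alternating (\<not> b) m" using c w z iz by auto
    then have "w \<noteq> alternating True m" "w \<noteq> alternating False m" by (cases b; simp)+
    then show ?thesis using total_count_less_alternating[of w b] w by (simp add: z mult)
  qed
  ultimately show ?thesis by blast
qed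

end
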